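(* Let $n\ge 1$, $p>1$ be integers, $A_0,A_1,\dots,A_n$ real symmetric $p\times p$ matrices, $\mathcal A(x)=A_0+\sum_{i=1}^n x_iA_i$, and suppose $X=\{x\in\mathbb R^n:\mathcal A(x)\in\mathcal{COP}^p\}\neq\emptyset$. Consider a run of the algorithm REG-LCoP (defined in the context) that stops at iteration $\#m_*$ with $m_*>0$, and let $Y_m,\mathcal F_m$, $m=0,1,\dots,m_*$, be the associated matrices and cones (defined in the context). Let $s_*\ge 0$ and $m_0,m_1,\dots,m_{s_*}\in\{0,1,\dots,m_*-1\}$ be such that $m_0=0$, $m_s<m_{s+1}$ for $s=0,\dots,s_*-1$, $m_{s_*}+1=m_*$, $$Y_{m_s+1}\notin\mathrm{span}\{Y_0,Y_1,\dots,Y_{m_s}\}\quad\forall s=0,1,\dots,s_*-1,$$ $$Y_{m_s+1+i}\in\mathrm{span}\{Y_0,Y_1,\dots,Y_{m_s+i}\}\quad\forall i=1,\dots,m_{s+1}-m_s-1,\ \forall s=0,1,\dots,s_*-1.$$ Set $\bar Y_0=Y_0$, $\bar{\mathcal F}_0=\mathcal F_0$, $\bar Y_{s+1}=Y_{m_s+1}$, $\bar{\mathcal F}_{s+1}=\mathcal F_{m_s+1}$ for $s=0,1,\dots,s_*$. Then $$\bar Y_s\in\bar{\mathcal F}_{s-1}^*,\quad \bar Y_s\in\mathrm{Ker}\,\mathcal A,\quad \bar{\mathcal F}_s=\bar{\mathcal F}_{s-1}\cap\{\bar Y_s\}^\perp\qquad\forall s=1,\dots,s_*+1,$$ $$\bar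 Y_s\notin\mathrm{span}\{\bar Y_0,\bar Y_1,\dots,\bar Y_{s-1}\}\qquad\forall s=1,\dots,s_*,$$ and consequently the number $s_*$ of core iterations satisfies $s_*\le\dim(\mathrm{Ker}\,\mathcal A)$.
   Context: Notation. $\mathcal S(p)$ is the space of real symmetric $p\times p$ matrices with inner product $A\bullet B=\mathrm{trace}(AB)$; $\mathcal{COP}^p=\{D\in\mathcal S(p): t^\top Dt\ge 0\ \forall t\in\mathbb R^p_+\}$; $\mathcal F^*=\{U\in\mathcal S(p):U\bullet D\ge 0\ \forall D\in\mathcal F\}$ is the dual cone; $\{Y\}^\perp=\{D\in\mathcal S(p):D\bullet Y=0\}$; $\mathrm{Ker}\,\mathcal A=\{D\in\mathcal S(p):A_j\bullet D=0\ \forall j=0,1,\dots,n\}$. $P=\{1,\dots,p\}$; $e_1,\dots,e_p$ is the standard basis of $\mathbb R^p$; $T=\{t\in\mathbb R^p_+:\sum_{k\in P}t_k=1\}$. For $t\in\mathbb R^p_+$: $P_+(t)=\{k\in P:t_k>0\}$, $P_0(t)=P\setminus P_+(t)$. Index families $(\tau(i))_{i\in I}$ are labelled by finite sets $I$. A set of indices $\{l,l+1,\dots,w\}$ is empty if $w<l$. For a finite nonempty set $V=\{\tau(i):i\in I\}\subset T$ put $\sigma(V)=\min\{\tau_k(i): k\in P_+(\tau(i)),\ i\in I\}>0$ and $\Omega(V)=\{t\in T:\rho(t,\mathrm{conv}\,V)\ge\sigma(V)\}$, where $\rho(l,\mathcal B)=\min_{\tau\in\mathcal B}\sum_{k\in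 P}|l_k-\tau_k|$. Algorithm REG-LCoP. Iteration $\#0$. Consider the problem $(SIP_0)$: minimize $\mu$ over $(x,\mu)\in\mathbb R^{n+1}$ subject to $t^\top\mathcal A(x)t+\mu\ge 0$ for all $t\in T$. If it has a feasible solution with $\mu<0$, stop with $m_*=0$. Otherwise choose a finite nonempty index set $I_1$, $|I_1|\le n+1$, and $\tau(i)\in T$, $\gamma(i)>0$ for $i\in I_1$, such that $\sum_{i\in I_1}\gamma(i)\tau(i)^\top A_j\tau(i)=0$ for $j=0,1,\dots,n$ and $\sum_{i\in I_1}\gamma(i)=1$. Set $L_1(i)=P_+(\tau(i))$, $i\in I_1$, and go to iteration $\#1$. Iteration $\#m$, $m\ge 1$. Given $\tau(i)\in T$ and $L_m(i)\subset P$, $i\in I_m$, set $W_m=\{\tau(i):i\in I_m\}$ and consider the problem $(SIP_m)$: minimize $\mu$ over $(x,\mu)\in\mathbb R^{n+1}$ subject to $e_k^\top\mathcal A(x)\tau(i)=0$ for all $k\in L_m(i)$ and $e_k^\top\mathcal A(x)\tau(i)\ge 0$ for all $k\in P\setminus L_m(i)$, for all $i\in I_m$, and $t^\top\mathcal A(x)t+\mu\ge 0$ for all $t\in\Omega(W_m)$. If it has a feasible solution with $\mu<0$, stop with $m_*=m$. Otherwise choose a finite index set $\Delta I_m$ disjoint from $I_m$ with $1\le|\Delta I_m|\le n+1$, points $\tau(i)\in\Omega(W_m)$ and numbers $\gamma(i)>0$ for $i\in\Delta I_m$, and vectors $\lambda^m(i)\in\mathbb R^p$ for $i\in I_m$,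 such that $$\sum_{i\in\Delta I_m}\gamma(i)\tau(i)^\top A_j\tau(i)+2\sum_{i\in I_m}\lambda^m(i)^\top A_j\tau(i)=0,\quad j=0,1,\dots,n,$$ $\lambda^m_k(i)\ge 0$ for all $k\in P\setminus L_m(i)$, $i\in I_m$, and $P_0(\tau(i))\cap P_+(\tau(j))\neq\emptyset$ for all $i\in\Delta I_m$, $j\in I_m$. Set $\Delta L(i)=\{k\in P\setminus L_m(i):\lambda_k^m(i)>0\}$ and $L_{m+1}(i)=L_m(i)\cup\Delta L(i)$ for $i\in I_m$; $L_{m+1}(i)=P_+(\tau(i))$ for $i\in\Delta I_m$; $I_{m+1}=I_m\cup\Delta I_m$; and go to iteration $\#(m+1)$. Associated matrices and cones. $Y_0$ is the $p\times p$ null matrix, $\mathcal F_0=\mathcal{COP}^p$, $Y_1=\sum_{i\in I_1}\gamma(i)\tau(i)\tau(i)^\top$, $Y_{m+1}=\sum_{i\in\Delta I_m}\gamma(i)\tau(i)\tau(i)^\top+\sum_{i\in I_m}[\tau(i)\lambda^m(i)^\top+\lambda^m(i)\tau(i)^\top]$ for $1\le m\le m_*-1$, and $\mathcal F_m=\mathcal F_{m-1}\cap\{Y_m\}^\perp$ for $m=1,\dots,m_*$. *)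

theory Defs
  imports "HOL-Analysis.Analysis"
begin

text \<open>The index set P of the coordinates is the (finite) type \<open>'p\<close>, so that P = UNIV.\<close>

definition sym_mats :: "(real ^ 'p ^ 'p) set" where
  "sym_mats = {D. transpose D = D}"

definition trace_ip :: "real ^ 'p ^ 'p \<Rightarrow> real ^ 'p ^ 'p \<Rightarrow> real"  (infixl "\<bullet>\<^sub>S" 70) where
  "A \<bullet>\<^sub>S B = trace (A ** B)"

definition nonneg_vecs :: "(real ^ 'p) set" where
  "nonneg_vecs = {t. \<forall>k. 0 \<le> t $ k}"

definition cop :: "(real ^ 'p ^ 'p) set" where
  "cop = {D \<in> sym_mats. \<forall>t\<in>nonneg_vecs. 0 \<le> t \<bullet> (D *v t)}"

definition dual_cone :: "(real ^ 'p ^ 'p) set \<Rightarrow> (real ^ 'p ^ 'p) set" where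
  "dual_cone F = {U \<in> sym_mats. \<forall>D\<in>F. 0 \<le> U \<bullet>\<^sub>S D}"

definition perp :: "real ^ 'p ^ 'p \<Rightarrow> (real ^ 'p ^ 'p) set" where
  "perp Y = {D \<in> sym_mats. D \<bullet>\<^sub>S Y = 0}"

definition outer :: "real ^ 'p \<Rightarrow> real ^ 'p \<Rightarrow> real ^ 'p ^ 'p" where
  "outer u v = (\<chi> i j. u $ i * v $ j)"

definition simplex_T :: "(real ^ 'p) set" where
  "simplex_T = {t \<in> nonneg_vecs. (\<Sum>k\<in>UNIV. t $ k) = 1}"

definition P_plus :: "real ^ 'p \<Rightarrow> 'p set" where
  "P_plus t = {k. t $ k > 0}"

definition P_zero :: "real ^ 'p \<Rightarrow> 'p set" where
  "P_zero t = UNIV - P_plus t"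

text \<open>The infimum in \<open>rho\<close> is a minimum for the compact nonempty sets \<open>B\<close>
  (convex hulls of finite nonempty sets) to which it is applied.\<close>

definition rho :: "real ^ 'p \<Rightarrow> (real ^ 'p) set \<Rightarrow> real" where
  "rho l B = (INF u\<in>B. \<Sum>k\<in>UNIV. \<bar>l $ k - u $ k\<bar>)"

definition sigma :: "(real ^ 'p) set \<Rightarrow> real" where
  "sigma V = Min {u $ k | u k. u \<in> V \<and> k \<in> P_plus u}"

definition Omega :: "(real ^ 'p) set \<Rightarrow> (real ^ 'p) set" where
  "Omega V = {t \<in> simplex_T. rho t (convex hull V) \<ge> sigma V}"


text \<open>The matrices of the problem are \<open>A0\<close> and the family \<open>A\<close> over the finite type \<open>'n\<close>
  with \<open>CARD('n)\<close> = n; the set of all of them is \<open>insert A0 (range A)\<close>.\<close>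

definition mat_fun ::
  "real ^ 'p ^ 'p \<Rightarrow> ('n::finite \<Rightarrow> real ^ 'p ^ 'p) \<Rightarrow> real ^ 'n \<Rightarrow> real ^ 'p ^ 'p" where
  "mat_fun A0 A x = A0 + (\<Sum>i\<in>UNIV. (x $ i) *\<^sub>R A i)"

definition Ker_A :: "real ^ 'p ^ 'p \<Rightarrow> ('n::finite \<Rightarrow> real ^ 'p ^ 'p) \<Rightarrow> (real ^ 'p ^ 'p) set" where
  "Ker_A A0 A = {D \<in> sym_mats. \<forall>B\<in>insert A0 (range A). B \<bullet>\<^sub>S D = 0}"

text \<open>Feasible set of the semi-infinite problem of iteration m.  Index labels are never reused,
  so one global family of points \<open>\<tau>\<close> serves all iterations;
  \<open>I m\<close> and \<open>L m i\<close> are relevant for m at least 1 and \<open>i \<in> I m\<close> only.\<close>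

definition sip_feasible ::
  "real ^ 'p ^ 'p \<Rightarrow> ('n::finite \<Rightarrow> real ^ 'p ^ 'p) \<Rightarrow> (nat \<Rightarrow> 'i set) \<Rightarrow> ('i \<Rightarrow> real ^ 'p)
    \<Rightarrow> (nat \<Rightarrow> 'i \<Rightarrow> 'p set) \<Rightarrow> nat \<Rightarrow> ((real ^ 'n) \<times> real) set" where
  "sip_feasible A0 A I \<tau> L m =
    (if m = 0 then
       {(x, \<mu>). \<forall>t\<in>simplex_T. t \<bullet> (mat_fun A0 A x *v t) + \<mu> \<ge> 0}
     else
       {(x, \<mu>).
          (\<forall>i\<in>I m. (\<forall>k\<in>L m i. axis k 1 \<bullet> (mat_fun A0 A x *v \<tau> i) = 0) \<and>
                    (\<forall>k\<in>UNIV - L m i. axis k 1 \<bullet> (mat_fun A0 A x *v \<tau> i) \<ge> 0)) \<and>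
          (\<forall>t\<in>Omega (\<tau> ` I m). t \<bullet> (mat_fun A0 A x *v t) + \<mu> \<ge> 0)})"

definition sip_stops ::
  "real ^ 'p ^ 'p \<Rightarrow> ('n::finite \<Rightarrow> real ^ 'p ^ 'p) \<Rightarrow> (nat \<Rightarrow> 'i set) \<Rightarrow> ('i \<Rightarrow> real ^ 'p)
    \<Rightarrow> (nat \<Rightarrow> 'i \<Rightarrow> 'p set) \<Rightarrow> nat \<Rightarrow> bool" where
  "sip_stops A0 A I \<tau> L m \<longleftrightarrow> (\<exists>x \<mu>. (x, \<mu>) \<in> sip_feasible A0 A I \<tau> L m \<and> \<mu> < 0)"

definition choice_zero ::
  "real ^ 'p ^ 'p \<Rightarrow> ('n::finite \<Rightarrow> real ^ 'p ^ 'p) \<Rightarrow> (nat \<Rightarrow> 'i set) \<Rightarrow> ('i \<Rightarrow> real ^ 'p)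
    \<Rightarrow> ('i \<Rightarrow> real) \<Rightarrow> (nat \<Rightarrow> 'i \<Rightarrow> 'p set) \<Rightarrow> bool" where
  "choice_zero A0 A I \<tau> \<gamma> L \<longleftrightarrow>
     finite (I 1) \<and> I 1 \<noteq> {} \<and> card (I 1) \<le> CARD('n) + 1 \<and>
     (\<forall>i\<in>I 1. \<tau> i \<in> simplex_T \<and> \<gamma> i > 0) \<and>
     (\<forall>B\<in>insert A0 (range A). (\<Sum>i\<in>I 1. \<gamma> i * (\<tau> i \<bullet> (B *v \<tau> i))) = 0) \<and>
     (\<Sum>i\<in>I 1. \<gamma> i) = 1 \<and>
     (\<forall>i\<in>I 1. L 1 i = P_plus (\<tau> i))"

definition choice_step ::
  "real ^ 'p ^ 'p \<Rightarrow> ('n::finite \<Rightarrow> real ^ 'p ^ 'p) \<Rightarrow> (nat \<Rightarrow> 'i set) \<Rightarrow> (nat \<Rightarrow> 'i set)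
    \<Rightarrow> ('i \<Rightarrow> real ^ 'p) \<Rightarrow> ('i \<Rightarrow> real) \<Rightarrow> (nat \<Rightarrow> 'i \<Rightarrow> real ^ 'p)
    \<Rightarrow> (nat \<Rightarrow> 'i \<Rightarrow> 'p set) \<Rightarrow> nat \<Rightarrow> bool" where
  "choice_step A0 A I \<Delta>I \<tau> \<gamma> lam L m \<longleftrightarrow>
     finite (\<Delta>I m) \<and> \<Delta>I m \<inter> I m = {} \<and>
     1 \<le> card (\<Delta>I m) \<and> card (\<Delta>I m) \<le> CARD('n) + 1 \<and>
     (\<forall>i\<in>\<Delta>I m. \<tau> i \<in> Omega (\<tau> ` I m) \<and> \<gamma> i > 0) \<and>
     (\<forall>B\<in>insert A0 (range A).
        (\<Sum>i\<in>\<Delta>I m. \<gamma> i * (\<tau> i \<bullet> (B *v \<tau> i))) +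
        2 * (\<Sum>i\<in>I m. lam m i \<bullet> (B *v \<tau> i)) = 0) \<and>
     (\<forall>i\<in>I m. \<forall>k\<in>UNIV - L m i. lam m i $ k \<ge> 0) \<and>
     (\<forall>i\<in>\<Delta>I m. \<forall>j\<in>I m. P_zero (\<tau> i) \<inter> P_plus (\<tau> j) \<noteq> {}) \<and>
     (\<forall>i\<in>I m. L (Suc m) i = L m i \<union> {k \<in> UNIV - L m i. lam m i $ k > 0}) \<and>
     (\<forall>i\<in>\<Delta>I m. L (Suc m) i = P_plus (\<tau> i)) \<and>
     I (Suc m) = I m \<union> \<Delta>I m"

definition reg_lcop_run ::
  "real ^ 'p ^ 'p \<Rightarrow> ('n::finite \<Rightarrow> real ^ 'p ^ 'p) \<Rightarrow> (nat \<Rightarrow> 'i set) \<Rightarrow> (nat \<Rightarrow> 'i set)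
    \<Rightarrow> ('i \<Rightarrow> real ^ 'p) \<Rightarrow> ('i \<Rightarrow> real) \<Rightarrow> (nat \<Rightarrow> 'i \<Rightarrow> real ^ 'p)
    \<Rightarrow> (nat \<Rightarrow> 'i \<Rightarrow> 'p set) \<Rightarrow> nat \<Rightarrow> bool" where
  "reg_lcop_run A0 A I \<Delta>I \<tau> \<gamma> lam L mstar \<longleftrightarrow>
     (\<forall>m<mstar. \<not> sip_stops A0 A I \<tau> L m \<and>
        (if m = 0 then choice_zero A0 A I \<tau> \<gamma> L
         else choice_step A0 A I \<Delta>I \<tau> \<gamma> lam L m)) \<and>
     sip_stops A0 A I \<tau> L mstar"

fun assoc_Y ::
  "(nat \<Rightarrow> 'i set) \<Rightarrow> (nat \<Rightarrow> 'i set) \<Rightarrow> ('i \<Rightarrow> real ^ 'p) \<Rightarrow> ('i \<Rightarrow> real)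
    \<Rightarrow> (nat \<Rightarrow> 'i \<Rightarrow> real ^ 'p) \<Rightarrow> nat \<Rightarrow> real ^ 'p ^ 'p" where
  "assoc_Y I \<Delta>I \<tau> \<gamma> lam 0 = 0"
| "assoc_Y I \<Delta>I \<tau> \<gamma> lam (Suc 0) = (\<Sum>i\<in>I 1. \<gamma> i *\<^sub>R outer (\<tau> i) (\<tau> i))"
| "assoc_Y I \<Delta>I \<tau> \<gamma> lam (Suc (Suc m)) =
     (\<Sum>i\<in>\<Delta>I (Suc m). \<gamma> i *\<^sub>R outer (\<tau> i) (\<tau> i)) +
     (\<Sum>i\<in>I (Suc m). outer (\<tau> i) (lam (Suc m) i) + outer (lam (Suc m) i) (\<tau> i))"

primrec assoc_F :: "(nat \<Rightarrow> real ^ 'p ^ 'p) \<Rightarrow> nat \<Rightarrow> (real ^ 'p ^ 'p) set" where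
  "assoc_F Y 0 = cop"
| "assoc_F Y (Suc m) = assoc_F Y m \<inter> perp (Y (Suc m))"

end

theory Submission
  imports Defs
begin

text \<open>Every \<open>D \<in> F m\<close> satisfies \<open>D \<tau>(i) \<ge> 0\<close> with equality in the coordinates of
  \<open>L m i\<close>. Indeed, all the terms \<open>\<gamma>(i) \<tau>(i)\<^sup>T D \<tau>(i)\<close> and \<open>2 \<lambda>(i)\<^sup>T D \<tau>(i)\<close>
  of \<open>D \<bullet> Y (m + 1)\<close> are then nonnegative, so \<open>Y (m + 1) \<in> (F m)\<^sup>*\<close>, and if
  \<open>D \<bullet> Y (m + 1) = 0\<close> they all vanish: a vanishing copositive form at \<open>\<tau>(i) \<ge> 0\<close> forces
  \<open>D \<tau>(i) \<ge> 0\<close>, and \<open>\<lambda>\<^sub>k(i) > 0\<close> forces \<open>(D \<tau>(i))\<^sub>k = 0\<close>, which restores the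
  invariant for \<open>m + 1\<close>. At a non-core iteration \<open>Y (m + 1)\<close> lies in the span of its
  predecessors, to which \<open>F m\<close> is already orthogonal, so the cone does not change.\<close>

section \<open>Trace inner product and symmetric matrices\<close>

lemma trace_ip_commute: "A \<bullet>\<^sub>S B = B \<bullet>\<^sub>S A"
  unfolding trace_ip_def by (rule trace_mul_sym)

lemma linear_trace_ip: "linear (\<lambda>Y. D \<bullet>\<^sub>S Y)"
proof (rule linearI)
  show "D \<bullet>\<^sub>S (x + y) = D \<bullet>\<^sub>S x + D \<bullet>\<^sub>S y" for x y
    unfolding trace_ip_def matrix_add_ldistrib trace_add ..
  show "D \<bullet>\<^sub>S (c *\<^sub>R x) = c *\<^sub>R (D \<bullet>\<^sub>S x)" for c x
    unfolding trace_ip_def trace_def matrix_matrix_mult_def vec_lambda_beta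
      vector_scaleR_component real_scaleR_def sum_distrib_left
    by (intro sum.cong refl mult.left_commute)
qed

lemmas trace_ip_simps =
  linear_add[OF linear_trace_ip] linear_scale[OF linear_trace_ip] linear_sum[OF linear_trace_ip]

lemma trace_ip_outer: "D \<bullet>\<^sub>S outer u v = v \<bullet> (D *v u)"
  unfolding trace_ip_def trace_def matrix_matrix_mult_def outer_def inner_vec_def
    matrix_vector_mult_def vec_lambda_beta inner_real_def sum_distrib_left
  by (intro sum.cong refl) (simp only: mult_ac)

lemma sym_mats_swap:
  assumes "D \<in> sym_mats"
  shows "u \<bullet> (D *v v) = v \<bullet> (D *v u)"
proof -
  have "transpose D = D" using assms by (simp add: sym_mats_def)
  then have "u v* D = D *v u" by (metis transpose_matrix_vector)
  then show ?thesis by (metis dot_lmul_matrix inner_commute)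
qed

lemma outer_add_outer_sym: "outer u v + outer v u \<in> sym_mats"
  by (simp add: sym_mats_def transpose_def outer_def vec_eq_iff mult.commute add.commute)

lemma subspace_sym_mats: "subspace sym_mats"
  by (auto simp: subspace_def sym_mats_def transpose_def vec_eq_iff)

lemma scaled_outer_sym: "c *\<^sub>R outer u u \<in> sym_mats"
  by (simp add: sym_mats_def transpose_def outer_def vec_eq_iff mult.commute)

lemma assoc_Y_sym: "assoc_Y I \<Delta>I \<tau> \<gamma> lam m \<in> sym_mats"
  by (induction I \<Delta>I \<tau> \<gamma> lam m rule: assoc_Y.induct)
    (auto intro!: subspace_add[OF subspace_sym_mats] subspace_sum[OF subspace_sym_mats]
      subspace_0[OF subspace_sym_mats] scaled_outer_sym outer_add_outer_sym)

lemma trace_ip_assoc_Y_one: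
  "D \<bullet>\<^sub>S assoc_Y I \<Delta>I \<tau> \<gamma> lam (Suc 0) = (\<Sum>i\<in>I 1. \<gamma> i * (\<tau> i \<bullet> (D *v \<tau> i)))"
  by (simp add: trace_ip_simps trace_ip_outer)

text \<open>Symmetry of \<open>D\<close> makes both outer products of a pair contribute equally,
  hence the factor 2. The right-hand side is the expression that \<open>choice_step\<close> sets to
  zero for the constraint matrices, so one formula serves both the kernel and the dual cone.\<close>

lemma trace_ip_assoc_Y_Suc:
  assumes "D \<in> sym_mats" "m > 0"
  shows "D \<bullet>\<^sub>S assoc_Y I \<Delta>I \<tau> \<gamma> lam (Suc m) =
    (\<Sum>i\<in>\<Delta>I m. \<gamma> i * (\<tau> i \<bullet> (D *v \<tau> i))) + 2 * (\<Sum>i\<in>I m. lam m i \<bullet> (D *v \<tau> i))"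
proof -
  obtain l where m: "m = Suc l" using assms(2) gr0_implies_Suc by blast
  have "\<tau> i \<bullet> (D *v lam m i) = lam m i \<bullet> (D *v \<tau> i)" for i
    by (rule sym_mats_swap[OF assms(1)])
  then show ?thesis
    by (simp add: m trace_ip_simps trace_ip_outer sum_distrib_left flip: mult_2)
qed

section \<open>Zeros of copositive forms\<close>

text \<open>First-order optimality: a small step from \<open>t\<close> along a coordinate axis stays
  in the orthant and changes the form to first order by twice \<open>(D *v t) $ k\<close>, so a
  negative value would make the form negative.\<close>

lemma copositive_zero_imp_image_nonneg:
  assumes D: "D \<in> cop" and t: "t \<in> nonneg_vecs" and z: "t \<bullet> (D *v t) = 0"
  shows "0 \<le> (D *v t) $ k"
proof (rule ccontr)
  assume "\<not> ?thesis"
  define c where "c = - (D *v t) $ k"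
  with \<open>\<not> ?thesis\<close> have c: "c > 0" by simp
  define q where "q = axis k 1 \<bullet> (D *v axis k 1)"
  \<comment> \<open>This step length gives \<open>e * q \<le> c\<close>, too little for the
    quadratic term to offset the linear one, which needs \<open>2 * c\<close>; adding 1 keeps the
    denominator positive.\<close>
  define e where "e = c / (\<bar>q\<bar> + 1)"
  have e: "e > 0" using c by (simp add: e_def)
  have sym: "D \<in> sym_mats" using D by (simp add: cop_def)
  have "t + e *\<^sub>R axis k 1 \<in> nonneg_vecs"
    using t e by (simp add: nonneg_vecs_def axis_def)
  then have "0 \<le> (t + e *\<^sub>R axis k 1) \<bullet> (D *v (t + e *\<^sub>R axis k 1))"
    using D by (simp add: cop_def)
  also have "\<dots> = e * (t \<bullet> (D *v axis k 1)) + e * (axis k 1 \<bullet> (D *v t)) + e * (e * q)"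
    using z by (simp add: matrix_vector_right_distrib matrix_vector_mult_scaleR inner_add_left
        inner_add_right q_def algebra_simps)
  also have "t \<bullet> (D *v axis k 1) = axis k 1 \<bullet> (D *v t)"
    by (rule sym_mats_swap[OF sym])
  also have "axis k 1 \<bullet> (D *v t) = - c" by (simp add: c_def inner_axis')
  finally have "0 \<le> e * (e * q - 2 * c)" by (simp add: algebra_simps)
  with e have "2 * c \<le> e * q" by (simp add: zero_le_mult_iff)
  also have "\<dots> \<le> e * (\<bar>q\<bar> + 1)" using e by (intro mult_left_mono) auto
  also have "\<dots> = c" by (simp add: e_def)
  finally show False using c by simp
qed

text \<open>The form at \<open>t\<close> is a sum of products \<open>t $ l * (D *v t) $ l\<close>,
  all nonnegative by the previous lemma, so its vanishing kills each of them.\<close>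

lemma copositive_zero_imp_image_zero_on_support:
  assumes D: "D \<in> cop" and t: "t \<in> nonneg_vecs" and z: "t \<bullet> (D *v t) = 0"
    and k: "k \<in> P_plus t"
  shows "(D *v t) $ k = 0"
proof -
  have "0 \<le> t $ l * (D *v t) $ l" for l
    using copositive_zero_imp_image_nonneg[OF D t z] t by (simp add: nonneg_vecs_def)
  moreover have "(\<Sum>l\<in>UNIV. t $ l * (D *v t) $ l) = 0"
    using z by (simp add: inner_vec_def)
  ultimately have "t $ k * (D *v t) $ k = 0"
    by (simp add: sum_nonneg_eq_0_iff)
  with k show ?thesis by (simp add: P_plus_def)
qed

section \<open>The decreasing chain of cones\<close>

lemma assoc_F_antimono: "m \<le> m' \<Longrightarrow> assoc_F Y m' \<subseteq> assoc_F Y m"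
  by (induction m' rule: dec_induct) auto

lemma assoc_F_subset_cop: "assoc_F Y m \<subseteq> cop"
  using assoc_F_antimono[of 0 m Y] by simp

lemma cop_subset_sym_mats: "cop \<subseteq> sym_mats"
  by (auto simp: cop_def)

text \<open>Orthogonality to each \<open>Y k\<close> with positive \<open>k\<close> is built into
  the chain; \<open>Y 0\<close> is never intersected with, which is why it is taken to be
  zero.\<close>

lemma assoc_F_trace_ip_span:
  assumes Y0: "Y 0 = 0" and D: "D \<in> assoc_F Y m" and Z: "Z \<in> span (Y ` {0..m})"
  shows "D \<bullet>\<^sub>S Z = 0"
proof -
  have "D \<bullet>\<^sub>S Y k = 0" if "k \<le> m" for k
  proof (cases k)
    case 0
    then show ?thesis using Y0 linear_0[OF linear_trace_ip] by simp
  next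
    case (Suc l)
    then show ?thesis using D assoc_F_antimono[OF that, of Y] by (auto simp: perp_def)
  qed
  then show ?thesis
    by (intro linear_eq_0_on_span[OF linear_trace_ip _ Z]) auto
qed

lemma assoc_F_Suc_eq:
  assumes "Y 0 = 0" and "Y (Suc m) \<in> span (Y ` {0..m})"
  shows "assoc_F Y (Suc m) = assoc_F Y m"
  using assoc_F_trace_ip_span[OF assms(1) _ assms(2)] assoc_F_subset_cop[of Y m]
    cop_subset_sym_mats
  by (auto simp: perp_def)

lemma assoc_F_const:
  assumes Y0: "Y 0 = 0" and "a \<le> b"
    and "\<And>m. a \<le> m \<Longrightarrow> m < b \<Longrightarrow> Y (Suc m) \<in> span (Y ` {0..m})"
  shows "assoc_F Y b = assoc_F Y a"
  using assms(2,3)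
proof (induction b rule: dec_induct)
  case (step b)
  then show ?case using assoc_F_Suc_eq[where Y = Y and m = b, OF Y0] by force
qed simp

section \<open>The complementarity invariant along a run\<close>

lemma Omega_subset_simplex_T: "Omega V \<subseteq> simplex_T"
  by (auto simp: Omega_def)

lemma simplex_T_subset_nonneg_vecs: "simplex_T \<subseteq> nonneg_vecs"
  by (auto simp: simplex_T_def)

lemma cop_simplex_nonneg:
  "D \<in> cop \<Longrightarrow> t \<in> simplex_T \<Longrightarrow> 0 \<le> t \<bullet> (D *v t)"
  using simplex_T_subset_nonneg_vecs by (auto simp: cop_def)

lemma run_choice_zero:
  "reg_lcop_run A0 A I \<Delta>I \<tau> \<gamma> lam L mstar \<Longrightarrow> 0 < mstar \<Longrightarrow> choice_zero A0 A I \<tau> \<gamma> L"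
  by (auto simp: reg_lcop_run_def)

lemma run_choice_step:
  "reg_lcop_run A0 A I \<Delta>I \<tau> \<gamma> lam L mstar \<Longrightarrow> 0 < m \<Longrightarrow> m < mstar
    \<Longrightarrow> choice_step A0 A I \<Delta>I \<tau> \<gamma> lam L m"
  by (auto simp: reg_lcop_run_def)

lemma run_finite_I:
  assumes run: "reg_lcop_run A0 A I \<Delta>I \<tau> \<gamma> lam L mstar" and "0 < m" "m \<le> mstar"
  shows "finite (I m)"
  using assms(2,3)
proof (induction m rule: nat_induct_non_zero)
  case 1
  then show ?case using run_choice_zero[OF run] by (simp add: choice_zero_def)
next
  case (Suc m)
  then show ?case using run_choice_step[OF run, of m] by (simp add: choice_step_def)
qed

text \<open>These are the linear constraints of \<open>sip_feasible\<close> at one point, with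
  \<open>D\<close> in place of \<open>mat_fun A0 A x\<close> and \<open>K\<close> in place of
  \<open>L m i\<close>.\<close>

definition complementary :: "real ^ 'p ^ 'p \<Rightarrow> real ^ 'p \<Rightarrow> 'p set \<Rightarrow> bool" where
  "complementary D t K \<longleftrightarrow> (\<forall>k. 0 \<le> (D *v t) $ k) \<and> (\<forall>k\<in>K. (D *v t) $ k = 0)"

text \<open>On \<open>K\<close> the second factor is zero, so \<open>l\<close> may have any sign
  there; off \<open>K\<close> both factors are nonnegative.\<close>

lemma complementary_mult_nonneg:
  assumes "complementary D t K" and "\<forall>k\<in>UNIV - K. 0 \<le> l $ k"
  shows "0 \<le> l $ k * (D *v t) $ k"
  using assms by (cases "k \<in> K") (auto simp: complementary_def)

lemma complementary_inner_nonneg: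
  assumes "complementary D t K" and "\<forall>k\<in>UNIV - K. 0 \<le> l $ k"
  shows "0 \<le> l \<bullet> (D *v t)"
  using complementary_mult_nonneg[OF assms] by (simp add: inner_vec_def sum_nonneg)

text \<open>Nonnegative products with zero sum all vanish, which forces
  \<open>(D *v t) $ k = 0\<close> wherever \<open>l $ k\<close> is positive. The enlarged set
  follows the update rule for \<open>L\<close>.\<close>

lemma complementary_extend:
  assumes c: "complementary D t K" and l: "\<forall>k\<in>UNIV - K. 0 \<le> l $ k"
    and z: "l \<bullet> (D *v t) = 0"
  shows "complementary D t (K \<union> {k \<in> UNIV - K. 0 < l $ k})"
proof -
  have "l $ k * (D *v t) $ k = 0" for k
    using z complementary_mult_nonneg[OF c l] by (simp add: inner_vec_def sum_nonneg_eq_0_iff)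
  then show ?thesis using c by (force simp: complementary_def)
qed

lemma complementary_zero:
  assumes "D \<in> cop" "t \<in> simplex_T" "t \<bullet> (D *v t) = 0"
  shows "complementary D t (P_plus t)"
  using assms simplex_T_subset_nonneg_vecs copositive_zero_imp_image_nonneg
    copositive_zero_imp_image_zero_on_support
  unfolding complementary_def by blast

lemma complementary_zeros:
  assumes fin: "finite J" and D: "D \<in> cop" and J: "\<forall>i\<in>J. \<tau> i \<in> simplex_T \<and> 0 < \<gamma> i"
    and z: "(\<Sum>i\<in>J. \<gamma> i * (\<tau> i \<bullet> (D *v \<tau> i))) = 0" and i: "i \<in> J"
  shows "complementary D (\<tau> i) (P_plus (\<tau> i))"
proof -
  have "\<gamma> i * (\<tau> i \<bullet> (D *v \<tau> i)) = 0"
    using z i J cop_simplex_nonneg[OF D] by (subst (asm) sum_nonneg_eq_0_iff[OF fin]) auto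
  with J i show ?thesis by (intro complementary_zero D) auto
qed

lemma cop_weighted_sum_nonneg:
  assumes "D \<in> cop" and "\<forall>i\<in>J. \<tau> i \<in> simplex_T \<and> 0 < \<gamma> i"
  shows "0 \<le> (\<Sum>i\<in>J. \<gamma> i * (\<tau> i \<bullet> (D *v \<tau> i)))"
  using assms by (intro sum_nonneg mult_nonneg_nonneg cop_simplex_nonneg) (auto intro: less_imp_le)

lemma choice_step_points:
  assumes "choice_step A0 A I \<Delta>I \<tau> \<gamma> lam L m"
  shows "\<forall>i\<in>\<Delta>I m. \<tau> i \<in> simplex_T \<and> 0 < \<gamma> i"
  using assms Omega_subset_simplex_T unfolding choice_step_def by blast

lemma choice_step_multipliers_nonneg:
  assumes "choice_step A0 A I \<Delta>I \<tau> \<gamma> lam L m"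
    and "\<forall>i\<in>I m. complementary D (\<tau> i) (L m i)" and "i \<in> I m"
  shows "0 \<le> lam m i \<bullet> (D *v \<tau> i)"
proof (rule complementary_inner_nonneg)
  show "complementary D (\<tau> i) (L m i)" using assms by blast
  show "\<forall>k\<in>UNIV - L m i. 0 \<le> lam m i $ k" using assms by (simp add: choice_step_def)
qed

text \<open>The induction starts at 1 because \<open>I\<close> and \<open>L\<close> carry no data at
  iteration 0.\<close>

lemma run_face_complementary:
  assumes run: "reg_lcop_run A0 A I \<Delta>I \<tau> \<gamma> lam L mstar" and "0 < m" "m \<le> mstar"
    and "D \<in> assoc_F (assoc_Y I \<Delta>I \<tau> \<gamma> lam) m"
  shows "\<forall>i\<in>I m. complementary D (\<tau> i) (L m i)"
  using assms(2-)
proof (induction m rule: nat_induct_non_zero)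
  case 1
  then have z: "(\<Sum>i\<in>I 1. \<gamma> i * (\<tau> i \<bullet> (D *v \<tau> i))) = 0" and D: "D \<in> cop"
    using trace_ip_assoc_Y_one[of D I] by (auto simp: perp_def)
  have c: "choice_zero A0 A I \<tau> \<gamma> L" using run_choice_zero[OF run] 1 by simp
  then show ?case
    using complementary_zeros[OF _ D _ z] by (auto simp: choice_zero_def)
next
  case (Suc m)
  let ?Y = "assoc_Y I \<Delta>I \<tau> \<gamma> lam"
  have c: "choice_step A0 A I \<Delta>I \<tau> \<gamma> lam L m"
    using run_choice_step[OF run] Suc by simp
  have DF: "D \<in> assoc_F ?Y m" and DY: "D \<bullet>\<^sub>S ?Y (Suc m) = 0"
    using Suc.prems(2) by (simp_all add: perp_def)
  have D: "D \<in> cop" using DF assoc_F_subset_cop by blast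
  have comp: "\<forall>i\<in>I m. complementary D (\<tau> i) (L m i)" using Suc DF by simp
  have fin: "finite (I m)" using run_finite_I[OF run] Suc by simp
  note pts = choice_step_points[OF c] and mult = choice_step_multipliers_nonneg[OF c comp]
  have "0 \<le> (\<Sum>i\<in>I m. lam m i \<bullet> (D *v \<tau> i))"
    using mult by (rule sum_nonneg)
  moreover have "(\<Sum>i\<in>\<Delta>I m. \<gamma> i * (\<tau> i \<bullet> (D *v \<tau> i))) +
      2 * (\<Sum>i\<in>I m. lam m i \<bullet> (D *v \<tau> i)) = 0"
    using DY trace_ip_assoc_Y_Suc[of D m I] D cop_subset_sym_mats Suc.hyps by auto
  \<comment> \<open>Two nonnegative quantities add up to zero, so both vanish.\<close>
  ultimately have z1: "(\<Sum>i\<in>\<Delta>I m. \<gamma> i * (\<tau> i \<bullet> (D *v \<tau> i))) = 0"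
    and z2: "(\<Sum>i\<in>I m. lam m i \<bullet> (D *v \<tau> i)) = 0"
    using cop_weighted_sum_nonneg[OF D pts] by linarith+
  show ?case
  proof
    fix i assume "i \<in> I (Suc m)"
    then consider "i \<in> I m" | "i \<in> \<Delta>I m" using c by (auto simp: choice_step_def)
    then show "complementary D (\<tau> i) (L (Suc m) i)"
    proof cases
      case 1
      have "lam m i \<bullet> (D *v \<tau> i) = 0"
        using z2 mult 1 by (subst (asm) sum_nonneg_eq_0_iff[OF fin]) auto
      moreover have "\<forall>k\<in>UNIV - L m i. 0 \<le> lam m i $ k"
        and "L (Suc m) i = L m i \<union> {k \<in> UNIV - L m i. 0 < lam m i $ k}"
        using c 1 by (simp_all add: choice_step_def)
      ultimately show ?thesis using complementary_extend[of D "\<tau> i" "L m i"] comp 1 by simp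
    next
      case 2
      then show ?thesis
        using complementary_zeros[OF _ D pts z1] c by (simp add: choice_step_def)
    qed
  qed
qed

lemma run_Y_in_dual_cone:
  assumes run: "reg_lcop_run A0 A I \<Delta>I \<tau> \<gamma> lam L mstar" and m: "m < mstar"
  shows "assoc_Y I \<Delta>I \<tau> \<gamma> lam (Suc m) \<in> dual_cone (assoc_F (assoc_Y I \<Delta>I \<tau> \<gamma> lam) m)"
proof -
  let ?Y = "assoc_Y I \<Delta>I \<tau> \<gamma> lam"
  have "0 \<le> D \<bullet>\<^sub>S ?Y (Suc m)" if DF: "D \<in> assoc_F ?Y m" for D
  proof -
    have D: "D \<in> cop" using DF assoc_F_subset_cop by blast
    show ?thesis
    \<comment> \<open>At \<open>m = 0\<close> there are no multipliers and copositivity alone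
      suffices; later the invariant controls the multiplier terms.\<close>
    proof (cases "m = 0")
      case True
      have "\<forall>i\<in>I 1. \<tau> i \<in> simplex_T \<and> 0 < \<gamma> i"
        using run_choice_zero[OF run] m True by (simp add: choice_zero_def)
      from cop_weighted_sum_nonneg[OF D this] show ?thesis
        unfolding True trace_ip_assoc_Y_one .
    next
      case False
      then have c: "choice_step A0 A I \<Delta>I \<tau> \<gamma> lam L m" using run_choice_step[OF run] m by simp
      have comp: "\<forall>i\<in>I m. complementary D (\<tau> i) (L m i)"
        using run_face_complementary[OF run _ _ DF] False m by simp
      have "0 \<le> (\<Sum>i\<in>I m. lam m i \<bullet> (D *v \<tau> i))"
        using choice_step_multipliers_nonneg[OF c comp] by (rule sum_nonneg)
      moreover have "D \<in> sym_mats" using D cop_subset_sym_mats by blast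
      ultimately show ?thesis
        using cop_weighted_sum_nonneg[OF D choice_step_points[OF c]] False
        by (simp add: trace_ip_assoc_Y_Suc)
    qed
  qed
  then show ?thesis
    by (simp add: dual_cone_def assoc_Y_sym trace_ip_commute[of "?Y (Suc m)"])
qed

lemma run_Y_in_Ker_A:
  assumes run: "reg_lcop_run A0 A I \<Delta>I \<tau> \<gamma> lam L mstar" and m: "m < mstar"
    and sym: "A0 \<in> sym_mats" "\<And>j. A j \<in> sym_mats"
  shows "assoc_Y I \<Delta>I \<tau> \<gamma> lam (Suc m) \<in> Ker_A A0 A"
proof -
  have "B \<bullet>\<^sub>S assoc_Y I \<Delta>I \<tau> \<gamma> lam (Suc m) = 0" if B: "B \<in> insert A0 (range A)" for B
  proof (cases "m = 0")
    case True
    then show ?thesis using run_choice_zero[OF run] m B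
      unfolding True trace_ip_assoc_Y_one choice_zero_def by blast
  next
    case False
    have "B \<in> sym_mats" using B sym by blast
    then show ?thesis using run_choice_step[OF run] m B False
      by (auto simp: trace_ip_assoc_Y_Suc choice_step_def)
  qed
  then show ?thesis by (simp add: Ker_A_def assoc_Y_sym)
qed

section \<open>Dimension count and the core iterations\<close>

text \<open>Each vector outside the span of its predecessors raises the dimension by one. Nothing is
  asked of \<open>v 0\<close>, so that the zero matrix \<open>Ybar 0\<close> can start the
  sequence.\<close>

lemma dim_ge_if_not_in_span:
  fixes v :: "nat \<Rightarrow> 'a::euclidean_space"
  assumes "\<And>s. 1 \<le> s \<Longrightarrow> s \<le> N \<Longrightarrow> v s \<notin> span (v ` {0..s - 1})"
  shows "N \<le> dim (v ` {0..N})"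
  using assms
proof (induction N)
  case (Suc N)
  have "v (Suc N) \<notin> span (v ` {0..N})" using Suc.prems[of "Suc N"] by simp
  then have "dim (v ` {0..Suc N}) = dim (v ` {0..N}) + 1"
    by (simp add: atLeast0_atMost_Suc dim_insert)
  then show ?case using Suc by simp
qed simp

theorem mainTheorem3:
  fixes A0 :: "real ^ 'p ^ 'p"
    and A :: "'n::finite \<Rightarrow> real ^ 'p ^ 'p"
    and I \<Delta>I :: "nat \<Rightarrow> 'i set"
    and \<tau> :: "'i \<Rightarrow> real ^ 'p"
    and \<gamma> :: "'i \<Rightarrow> real"
    and lam :: "nat \<Rightarrow> 'i \<Rightarrow> real ^ 'p"
    and L :: "nat \<Rightarrow> 'i \<Rightarrow> 'p set"
    and mstar sstar :: nat
    and ms :: "nat \<Rightarrow> nat"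
    and Y Ybar :: "nat \<Rightarrow> real ^ 'p ^ 'p"
    and F Fbar :: "nat \<Rightarrow> (real ^ 'p ^ 'p) set"
  assumes p_gt_1: "CARD('p) > 1"
    and sym: "A0 \<in> sym_mats" "\<And>j. A j \<in> sym_mats"
    and X_nonempty: "{x :: real ^ 'n. mat_fun A0 A x \<in> cop} \<noteq> {}"
    and run: "reg_lcop_run A0 A I \<Delta>I \<tau> \<gamma> lam L mstar"
    and mstar_pos: "mstar > 0"
    and Y: "Y = assoc_Y I \<Delta>I \<tau> \<gamma> lam"
    and F: "F = assoc_F Y"
    and ms_range: "\<forall>s\<in>{0..sstar}. ms s \<in> {0..mstar - 1}"
    and ms_0: "ms 0 = 0"
    and ms_less: "\<forall>s<sstar. ms s < ms (s + 1)"
    and ms_last: "ms sstar + 1 = mstar"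
    and core: "\<forall>s<sstar. Y (ms s + 1) \<notin> span (Y ` {0..ms s})"
    and non_core: "\<forall>s<sstar. \<forall>i\<in>{1..ms (s + 1) - ms s - 1}.
                     Y (ms s + 1 + i) \<in> span (Y ` {0..ms s + i})"
    and Ybar_0: "Ybar 0 = Y 0"
    and Fbar_0: "Fbar 0 = F 0"
    and Ybar_Suc: "\<forall>s\<in>{0..sstar}. Ybar (s + 1) = Y (ms s + 1)"
    and Fbar_Suc: "\<forall>s\<in>{0..sstar}. Fbar (s + 1) = F (ms s + 1)"
  shows "(\<forall>s\<in>{1..sstar + 1}. Ybar s \<in> dual_cone (Fbar (s - 1)) \<and>
                              Ybar s \<in> Ker_A A0 A \<and>
                              Fbar s = Fbar (s - 1) \<inter> perp (Ybar s)) \<and>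
         (\<forall>s\<in>{1..sstar}. Ybar s \<notin> span (Ybar ` {0..s - 1})) \<and>
         sstar \<le> dim (Ker_A A0 A)"
proof -
  have Y0: "Y 0 = 0" by (simp add: Y)
  have ms_lt: "ms s < mstar" if "s \<le> sstar" for s
  proof -
    have "ms s \<in> {0..mstar - 1}" using ms_range that by simp
    then show ?thesis using mstar_pos by simp
  qed
  \<comment> \<open>\<open>Fbar s\<close> is defined right after core iteration
    \<open>ms (s - 1)\<close>, whereas the dual-cone property of \<open>Y (ms s + 1)\<close> refers
    to \<open>F (ms s)\<close>; the non-core iterations in between leave the cone unchanged.\<close>
  have face: "Fbar s = F (ms s)" if "s \<le> sstar" for s
  proof (cases s)
    case 0
    then show ?thesis using Fbar_0 ms_0 by simp
  next
    case (Suc r)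
    then have r: "r < sstar" using that by simp
    have "assoc_F Y (ms s) = assoc_F Y (ms r + 1)"
    proof (rule assoc_F_const[where Y = Y, OF Y0])
      show "ms r + 1 \<le> ms s" using ms_less r Suc by (simp add: Suc_le_eq)
      fix m assume m: "ms r + 1 \<le> m" "m < ms s"
      \<comment> \<open>The offset \<open>i = m - ms r\<close> turns \<open>ms r + 1 + i\<close>
        into \<open>Suc m\<close>.\<close>
      have "m - ms r \<in> {1..ms (r + 1) - ms r - 1}" using m Suc by auto
      with non_core r have "Y (ms r + 1 + (m - ms r)) \<in> span (Y ` {0..ms r + (m - ms r)})"
        by blast
      then show "Y (Suc m) \<in> span (Y ` {0..m})" using m by simp
    qed
    then show ?thesis using Fbar_Suc r Suc F by simp
  qed
  have step: "Ybar s \<in> dual_cone (Fbar (s - 1)) \<and> Ybar s \<in> Ker_A A0 A \<and>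
      Fbar s = Fbar (s - 1) \<inter> perp (Ybar s)" if "s \<in> {1..sstar + 1}" for s
  proof -
    obtain r where s: "s = Suc r" and r: "r \<le> sstar" using \<open>s \<in> _\<close> by (cases s) auto
    have "Ybar s = Y (Suc (ms r))" "Fbar s = F (Suc (ms r))" "Fbar (s - 1) = F (ms r)"
      using Ybar_Suc Fbar_Suc face[OF r] s r by auto
    then show ?thesis
      using run_Y_in_dual_cone[OF run ms_lt[OF r]] run_Y_in_Ker_A[OF run ms_lt[OF r] sym]
      by (simp add: F Y)
  qed
  \<comment> \<open>The range ends at \<open>sstar\<close>: \<open>Ybar (sstar + 1)\<close> comes
    from the last iteration, for which \<open>core\<close> asserts nothing.\<close>
  have indep: "Ybar s \<notin> span (Ybar ` {0..s - 1})" if "s \<in> {1..sstar}" for s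
  proof -
    obtain r where s: "s = Suc r" and r: "r < sstar" using \<open>s \<in> _\<close> by (cases s) auto
    have mono: "ms a \<le> ms b" if "a \<le> b" "b \<le> sstar" for a b
      using that
    proof (induction b rule: dec_induct)
      case (step b)
      have "ms b < ms (b + 1)" using ms_less step.prems by simp
      then show ?case using step.IH step.prems by simp
    qed simp
    \<comment> \<open>The earlier \<open>Ybar\<close> are among \<open>Y 0\<close> to
      \<open>Y (ms r)\<close>, so lying outside the larger span in \<open>core\<close> is
      enough.\<close>
    have "Ybar q \<in> Y ` {0..ms r}" if "q \<le> r" for q
    proof (cases q)
      case 0
      then show ?thesis using Ybar_0 by simp
    next
      case (Suc u)
      then have "Ybar q = Y (ms u + 1)" and "ms u < ms q" and "ms q \<le> ms r"
        using Ybar_Suc ms_less mono that r by auto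
      then show ?thesis by auto
    qed
    then have "span (Ybar ` {0..r}) \<subseteq> span (Y ` {0..ms r})"
      by (intro span_mono) auto
    moreover have "Ybar s = Y (ms r + 1)" using Ybar_Suc s r by simp
    ultimately show ?thesis using core r s by auto
  qed
  have "Ybar s \<in> Ker_A A0 A" if "s \<le> sstar" for s
  proof (cases s)
    case 0
    then show ?thesis
      using Ybar_0 Y0
      by (simp add: Ker_A_def linear_0[OF linear_trace_ip] subspace_0[OF subspace_sym_mats])
  next
    case (Suc r)
    then show ?thesis using step[of s] that by simp
  qed
  then have "dim (Ybar ` {0..sstar}) \<le> dim (Ker_A A0 A)"
    by (intro dim_subset) auto
  moreover have "sstar \<le> dim (Ybar ` {0..sstar})"
    by (rule dim_ge_if_not_in_span) (use indep in auto)
  ultimately show ?thesis using step indep by auto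
qed

end
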